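(* Let $A\in\mathbb{R}^{n\times n}$, $B\in\mathbb{R}^{n\times m}$, and let $\mathcal{D}=\{(U_i,X_{0,i},X_i)\}_{i=1}^{M}$ be a (noiseless) dataset generated by the system $x(t+1)=Ax(t)+Bu(t)$ with experiment horizons $T_1,\dots,T_M$, as described in the context. Let $k_1,\dots,k_\ell\in\{1,\dots,M\}$ be (possibly repeated) indices and $T=\sum_{i=1}^{\ell}T_{k_i}$. Suppose that $\begin{bmatrix}X_{0,k_i}\\ U_{k_i}\end{bmatrix}$ has full row rank for all $i\in\{1,\dots,\ell\}$. Then every pair $(u_T,x_{k_1,\dots,k_\ell})$, consisting of an input sequence $u_T\in\mathbb{R}^{mT}$ and the corresponding state trajectory of the system (from an arbitrary initial state $x(0)=x_0\in\mathbb{R}^n$) sampled at times $0,T_{k_1},T_{k_1}+T_{k_2},\dots,T$, satisfies $$\begin{bmatrix}u_T\\ x_{k_1,\dots,k_\ell}\end{bmatrix}=\begin{bmatrix}G\\ H\end{bmatrix}\alpha\qquad\text{for some }\alpha\in\mathbb{R}^{q_{k_\ell}+\dots+q_{k_1}+n},$$ where $q_{k_i}=\dim\operatorname{Ker}(X_{0,k_i})$ and, for $i\in\{1,\dots,\ell\}$, $$\tilde U_i=U_{k_i}K_{X_{0,k_i}},\qquad \tilde X_i=X_{k_i}K_{X_{0,k_i}},\qquad Q_i=X_{k_i}K_{U_{k_i}}(X_{0,k_i}K_{U_{k_i}})^{\dagger},$$ $$G=\begin{bmatrix}\tilde U_\ell&0&\cdots&0&0\\ 0&\tilde U_{\ell-1}&\ddots&\vdots&\vdots\\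 \vdots&\ddots&\ddots&0&0\\ 0&\cdots&0&\tilde U_1&0\end{bmatrix},$$ $$H=\begin{bmatrix}0&\cdots&0&0&I_n\\ 0&\cdots&0&\tilde X_1&Q_1\\ 0&\cdots&\tilde X_2&Q_2\tilde X_1&Q_2Q_1\\ \vdots& &\vdots&\vdots&\vdots\\ \tilde X_\ell&\cdots&Q_\ell\cdots Q_3\tilde X_2&Q_\ell\cdots Q_2\tilde X_1&Q_\ell Q_{\ell-1}\cdots Q_1\end{bmatrix}.$$ Explicitly, partitioning $\alpha=[\alpha_\ell^{\mathsf T},\dots,\alpha_1^{\mathsf T},\alpha_0^{\mathsf T}]^{\mathsf T}$ with $\alpha_i\in\mathbb{R}^{q_{k_i}}$ for $i\ge 1$ and $\alpha_0\in\mathbb{R}^n$, $G\alpha$ is the stack of $\tilde U_\ell\alpha_\ell,\dots,\tilde U_1\alpha_1$, and $H\alpha$ is the stack of the blocks $Q_j\cdots Q_1\alpha_0+\sum_{i=1}^{j}Q_j\cdots Q_{i+1}\tilde X_i\alpha_i$ for $j=0,1,\dots,\ell$ (empty products equal the identity).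
   Context: System: $x(t+1)=Ax(t)+Bu(t)$, $x(0)=x_0\in\mathbb{R}^n$, with $x(t)\in\mathbb{R}^n$, $u(t)\in\mathbb{R}^m$. The $T$-steps controllability matrix is $C_T=[B\ \ AB\ \cdots\ A^{T-1}B]$. A $T$-steps input sequence is written in reversed time order as $u_T=[u(T-1)^{\mathsf T},\dots,u(0)^{\mathsf T}]^{\mathsf T}\in\mathbb{R}^{mT}$, so that $x(T)=A^Tx(0)+C_Tu_T$. Dataset: there are $M$ distinct horizons $T_1,\dots,T_M\in\mathbb{N}$ (positive integers). For each $i$, $N_i$ experiments of horizon $T_i$ are performed with arbitrary inputs and initial states. $U_i\in\mathbb{R}^{mT_i\times N_i}$, $X_{0,i}\in\mathbb{R}^{n\times N_i}$, $X_i\in\mathbb{R}^{n\times N_i}$ collect as columns the input sequences (each stacked in reversed time order, i.e. as $[u(T_i-1)^{\mathsf T},\dots,u(0)^{\mathsf T}]^{\mathsf T}$), the initial states, and the states at time $T_i$, respectively; thus $X_i=A^{T_i}X_{0,i}+C_{T_i}U_i$. Sampled trajectory: $x_{k_1,\dots,k_\ell}=[x(0)^{\mathsf T},x(T_{k_1})^{\mathsf T},x(T_{k_1}+T_{k_2})^{\mathsf T},\dots,x(T)^{\mathsf T}]^{\mathsf T}\in\mathbb{R}^{n(\ell+1)}$. Notation: $A^\dagger$ is the Moore–Penrose pseudoinverse; $K_A$ is a matrix whose columns form a basis of $\operatorname{Ker}(A)$ (any fixed choice of basis). *)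

theory Defs
  imports Complex_Main "Jordan_Normal_Form.Matrix_Kernel" "Jordan_Normal_Form.DL_Rank"
begin

primrec state :: "real mat \<Rightarrow> real mat \<Rightarrow> real vec \<Rightarrow> (nat \<Rightarrow> real vec) \<Rightarrow> nat \<Rightarrow> real vec" where
  "state A B x0 u 0 = x0"
| "state A B x0 u (Suc t) = A *\<^sub>v state A B x0 u t + B *\<^sub>v u t"

definition stack :: "'a :: zero vec list \<Rightarrow> 'a vec" where
  "stack vs = foldr (@\<^sub>v) vs (0\<^sub>v 0)"

(* Reversed time order: u (T - 1) is on top, u 0 at the bottom. *)
definition input_stack :: "(nat \<Rightarrow> real vec) \<Rightarrow> nat \<Rightarrow> real vec" where
  "input_stack u T = stack (map u (rev [0..<T]))"

(* N experiments of horizon T on x(t+1) = A x(t) + B u(t), with n states and m inputs: the j-th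
   columns of U, X0 and X record the inputs, the initial state and the state at time T of the
   j-th experiment. *)
definition experiment_data ::
  "nat \<Rightarrow> nat \<Rightarrow> real mat \<Rightarrow> real mat \<Rightarrow> nat \<Rightarrow> nat \<Rightarrow> real mat \<Rightarrow> real mat \<Rightarrow> real mat \<Rightarrow> bool" where
  "experiment_data n m A B T N U X0 X \<longleftrightarrow>
     U \<in> carrier_mat (m * T) N \<and> X0 \<in> carrier_mat n N \<and> X \<in> carrier_mat n N \<and>
     (\<forall>j<N. \<exists>u. (\<forall>t<T. u t \<in> carrier_vec m) \<and>
        col U j = input_stack u T \<and> col X j = state A B (col X0 j) u T)"

definition full_row_rank :: "real mat \<Rightarrow> bool" where
  "full_row_rank C \<longleftrightarrow> vec_space.rank (dim_row C) C = dim_row C"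

(* The columns of K form a basis of Ker C. As kernel.basis is about sets, repeated columns have
   to be excluded separately. *)
definition kernel_basis_matrix :: "real mat \<Rightarrow> real mat \<Rightarrow> bool" where
  "kernel_basis_matrix C K \<longleftrightarrow>
     dim_row K = dim_col C \<and> distinct (cols K) \<and> kernel.basis (dim_col C) C (set (cols K))"

(* The four Penrose conditions, which determine the pseudoinverse uniquely. *)
definition moore_penrose_inverse :: "real mat \<Rightarrow> real mat \<Rightarrow> bool" where
  "moore_penrose_inverse C P \<longleftrightarrow>
     P \<in> carrier_mat (dim_col C) (dim_row C) \<and>
     C * P * C = C \<and> P * C * P = P \<and>
     transpose_mat (C * P) = C * P \<and> transpose_mat (P * C) = P * C"

definition pinv :: "real mat \<Rightarrow> real mat" where
  "pinv C = (THE P. moore_penrose_inverse C P)"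

definition append_cols :: "'a :: zero mat \<Rightarrow> 'a mat \<Rightarrow> 'a mat" where
  "append_cols A B = four_block_mat A B (0\<^sub>m 0 (dim_col A)) (0\<^sub>m 0 (dim_col B))"

(* Horizontal concatenation of blocks with nr rows, and vertical concatenation of blocks with nc
   columns; nr and nc only matter for empty lists. *)
definition block_row :: "nat \<Rightarrow> 'a :: zero mat list \<Rightarrow> 'a mat" where
  "block_row nr Cs = foldr append_cols Cs (0\<^sub>m nr 0)"

definition block_col :: "nat \<Rightarrow> 'a :: zero mat list \<Rightarrow> 'a mat" where
  "block_col nc Cs = foldr (@\<^sub>r) Cs (0\<^sub>m 0 nc)"

(* Q j * ... * Q (i + 1), the n x n identity if j \<le> i *)
definition desc_prod :: "nat \<Rightarrow> (nat \<Rightarrow> real mat) \<Rightarrow> nat \<Rightarrow> nat \<Rightarrow> real mat" where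
  "desc_prod n Q i j = foldr (*) (map Q (rev [Suc i..<Suc j])) (1\<^sub>m n)"

(* Block rows i = l, ..., 1; block columns j = l, ..., 1 followed by n zero columns. *)
definition G_mat :: "nat \<Rightarrow> nat \<Rightarrow> (nat \<Rightarrow> real mat) \<Rightarrow> real mat" where
  "G_mat n l Ut =
     block_col ((\<Sum>i = 1..l. dim_col (Ut i)) + n)
       (map (\<lambda>i. block_row (dim_row (Ut i))
           (map (\<lambda>j. if j = i then Ut i else 0\<^sub>m (dim_row (Ut i)) (dim_col (Ut j))) (rev [1..<Suc l])
            @ [0\<^sub>m (dim_row (Ut i)) n]))
         (rev [1..<Suc l]))"

(* Block rows j = 0, ..., l; block columns i = l, ..., 1 followed by the one acting on x(0). *)
definition H_mat :: "nat \<Rightarrow> nat \<Rightarrow> (nat \<Rightarrow> real mat) \<Rightarrow> (nat \<Rightarrow> real mat) \<Rightarrow> real mat" where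
  "H_mat n l Xt Q =
     block_col ((\<Sum>i = 1..l. dim_col (Xt i)) + n)
       (map (\<lambda>j. block_row n
           (map (\<lambda>i. if i \<le> j then desc_prod n Q i j * Xt i else 0\<^sub>m n (dim_col (Xt i))) (rev [1..<Suc l])
            @ [desc_prod n Q 0 j]))
         [0..<Suc l])"

end

theory Submission
  imports Defs
begin

text \<open>Over an experiment of horizon \<open>t\<close> the final state is a linear map \<open>P x + C w\<close> of the initial
  state and the stacked input, so the data satisfy \<open>X = P X\<^sub>0 + C U\<close>. Full row rank makes
  \<open>v \<mapsto> (X\<^sub>0 v, U v)\<close> surjective; restricted to \<open>Ker U\<close> this yields \<open>Q = P\<close>, and restricted to
  \<open>Ker X\<^sub>0\<close> it represents every input \<open>w\<close> as \<open>U K a\<close>, where then \<open>X K a = C w\<close>. Cutting a trajectory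
  at the sampling times yields \<open>z\<^sub>i = Q\<^sub>i z\<^sub>i\<^sub>-\<^sub>1 + X\<^sub>i K\<^sub>i a\<^sub>i\<close>, and the block rows of \<open>G\<close> and \<open>H\<close> unroll this
  recursion.\<close>

section \<open>Full row rank and bases of kernels\<close>

text \<open>A maximal independent set of columns has as many elements as the rank. Full row rank
  makes this number the dimension of the target space, so these columns form a basis and already
  span \<open>y\<close>.\<close>

lemma full_row_rank_surj:
  assumes "full_row_rank C" and y: "y \<in> carrier_vec (dim_row C)"
  shows "\<exists>v\<in>carrier_vec (dim_col C). C *\<^sub>v v = y"
proof -
  interpret vec_space "TYPE(real)" "dim_row C" .
  let ?cols = "set (cols C)"
  have C: "C \<in> carrier_mat (dim_row C) (dim_col C)" by simp
  have cols: "?cols \<subseteq> carrier_vec (dim_row C)" by (rule cols_dim)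
  obtain S where S: "maximal S (\<lambda>T. T \<subseteq> ?cols \<and> lin_indpt T)"
    using maximal_exists_superset[of ?cols "\<lambda>T. T \<subseteq> ?cols \<and> lin_indpt T" "{}"]
    by (auto simp: lin_dep_def)
  have S_cols: "S \<subseteq> ?cols" and S_indpt: "lin_indpt S" using S by (auto simp: maximal_def)
  have "card S = dim"
    using rank_card_indpt[OF C S] assms(1)[unfolded full_row_rank_def] dim_is_n by metis
  then have "basis S"
    using dim_li_is_basis[OF fin_dim finite_subset[OF S_cols] _ S_indpt] subset_trans[OF S_cols cols] by simp
  then have "carrier_vec (dim_row C) = span S" by (simp add: basis_def)
  also have "\<dots> \<subseteq> col_space C" unfolding col_space_def by (rule span_is_monotone[OF S_cols])
  finally show ?thesis using y unfolding col_space_eq[OF C] by auto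
qed

text \<open>Distinctness of the columns turns the cardinality of the basis into a number of columns.
  This identifies the width of \<open>K\<close> with the block sizes \<open>q\<close> of the
  theorem.\<close>

lemma kernel_basis_matrix_dim_col:
  assumes "kernel_basis_matrix C K"
  shows "dim_col K = kernel_dim C"
proof -
  interpret kernel "dim_row C" "dim_col C" C by unfold_locales simp
  have "kernel_dim C = card (set (cols K))"
    using assms Ker.dim_basis[of "set (cols K)"] by (simp add: kernel_basis_matrix_def)
  also have "\<dots> = dim_col K"
    using assms distinct_card[of "cols K"] by (simp add: kernel_basis_matrix_def)
  finally show ?thesis by simp
qed

text \<open>Used for \<open>U * KU\<close>: its vanishing removes the influence of the inputs from
  \<open>X * KU\<close>.\<close>

lemma mult_kernel_basis_matrix:
  assumes K: "kernel_basis_matrix C K"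
  shows "C * K = 0\<^sub>m (dim_row C) (dim_col K)"
proof (rule mat_col_eqI)
  interpret kernel "dim_row C" "dim_col C" C by unfold_locales simp
  fix j assume "j < dim_col (0\<^sub>m (dim_row C) (dim_col K) :: real mat)"
  then have j: "j < dim_col K" by simp
  then have "col K j \<in> set (cols K)" by (metis cols_length cols_nth nth_mem)
  moreover have "set (cols K) \<subseteq> mat_kernel C"
    using K unfolding kernel_basis_matrix_def Ker.basis_def by blast
  ultimately have "C *\<^sub>v col K j = 0\<^sub>v (dim_row C)" by (auto simp: mat_kernel_def)
  moreover have "K \<in> carrier_mat (dim_col C) (dim_col K)"
    using K by (auto simp: kernel_basis_matrix_def)
  then have "col (C * K) j = C *\<^sub>v col K j" by (rule col_mult2[OF carrier_matI[OF refl refl] _ j])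
  ultimately show "col (C * K) j = col (0\<^sub>m (dim_row C) (dim_col K)) j" using j by simp
qed simp_all

lemma kernel_basis_matrix_surj:
  assumes K: "kernel_basis_matrix C K"
    and v: "v \<in> carrier_vec (dim_col C)" and Cv: "C *\<^sub>v v = 0\<^sub>v (dim_row C)"
  shows "\<exists>a\<in>carrier_vec (dim_col K). K *\<^sub>v a = v"
proof -
  interpret kernel "dim_row C" "dim_col C" C by unfold_locales simp
  have K': "K \<in> carrier_mat (dim_col C) (dim_col K)"
    using K by (auto simp: kernel_basis_matrix_def)
  have "v \<in> mat_kernel C" using v Cv by (simp add: mat_kernel_def)
  \<comment> \<open>Spans formed inside the kernel agree with spans in the ambient space, where the
    span of the columns is the column space of \<open>K\<close>.\<close>
  also have "mat_kernel C = NC.span (set (cols K))"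
    using K span_same[of "set (cols K)"] by (auto simp: kernel_basis_matrix_def Ker.basis_def)
  finally have "v \<in> NC.col_space K" by (simp add: NC.col_space_def)
  then show ?thesis unfolding NC.col_space_eq[OF K'] by auto
qed

section \<open>The pseudoinverse of a surjective real matrix\<close>

lemma real_scalar_prod_self_eq_0:
  fixes v :: "real vec"
  assumes "v \<in> carrier_vec n" "v \<bullet> v = 0"
  shows "v = 0\<^sub>v n"
proof (rule eq_vecI)
  have "(\<Sum>i\<in>{0..<n}. v $ i * v $ i) = 0" using assms by (simp add: scalar_prod_def)
  then have "\<forall>i\<in>{0..<n}. v $ i * v $ i = 0" by (subst (asm) sum_nonneg_eq_0_iff) simp_all
  then show "v $ i = 0\<^sub>v n $ i" if "i < dim_vec (0\<^sub>v n :: real vec)" for i using that by simp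
qed (use assms in simp)

text \<open>Inserting \<open>C = C * P' * C\<close> and transposing a product of symmetric matrices
  gives \<open>C * P = C * P'\<close>; the mirrored argument gives \<open>P * C = P' * C\<close>.
  Then \<open>P = P' * C * P = P' * C * P' = P'\<close>.\<close>

lemma moore_penrose_inverse_unique:
  assumes "moore_penrose_inverse C P" "moore_penrose_inverse C P'"
  shows "P = P'"
proof -
  let ?n = "dim_row C" and ?k = "dim_col C"
  have C: "C \<in> carrier_mat ?n ?k" by simp
  have P: "P \<in> carrier_mat ?k ?n" and P': "P' \<in> carrier_mat ?k ?n"
    using assms by (auto simp: moore_penrose_inverse_def)
  have pen: "C * P * C = C" "P * C * P = P" "(C * P)\<^sup>T = C * P" "(P * C)\<^sup>T = P * C"
    and pen': "C * P' * C = C" "P' * C * P' = P'" "(C * P')\<^sup>T = C * P'" "(P' * C)\<^sup>T = P' * C"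
    using assms by (auto simp: moore_penrose_inverse_def)
  have CP: "C * P \<in> carrier_mat ?n ?n" and CP': "C * P' \<in> carrier_mat ?n ?n"
    and PC: "P * C \<in> carrier_mat ?k ?k" and PC': "P' * C \<in> carrier_mat ?k ?k"
    using C P P' by (auto intro: mult_carrier_mat)
  have "C * P = (C * P' * C) * P" by (simp only: pen'(1))
  also have "\<dots> = (C * P') * (C * P)" by (rule assoc_mult_mat[OF CP' C P])
  also have "\<dots> = ((C * P) * (C * P'))\<^sup>T"
    by (simp only: transpose_mult[OF CP CP'] pen(3) pen'(3))
  also have "(C * P) * (C * P') = (C * P * C) * P'" by (rule assoc_mult_mat[OF CP C P', symmetric])
  finally have eq1: "C * P = C * P'" by (simp only: pen(1) pen'(3))
  have "P * C = P * (C * P' * C)" by (simp only: pen'(1))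
  also have "\<dots> = P * (C * (P' * C))" by (simp only: assoc_mult_mat[OF C P' C])
  also have "\<dots> = (P * C) * (P' * C)" by (rule assoc_mult_mat[OF P C PC', symmetric])
  also have "\<dots> = ((P' * C) * (P * C))\<^sup>T"
    by (simp only: transpose_mult[OF PC' PC] pen(4) pen'(4))
  also have "(P' * C) * (P * C) = P' * (C * (P * C))" by (rule assoc_mult_mat[OF P' C PC])
  also have "\<dots> = P' * (C * P * C)" by (simp only: assoc_mult_mat[OF C P C])
  finally have eq2: "P * C = P' * C" by (simp only: pen(1) pen'(4))
  have "P = P' * C * P" by (simp only: eq2[symmetric] pen(2))
  also have "\<dots> = P' * (C * P')" by (simp only: assoc_mult_mat[OF P' C P] eq1)
  also have "\<dots> = P'" by (simp only: assoc_mult_mat[OF P' C P', symmetric] pen'(2))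
  finally show ?thesis .
qed

lemma pinv_eq:
  assumes "moore_penrose_inverse C P"
  shows "pinv C = P"
  unfolding pinv_def
  by (rule the_equality[where P = "moore_penrose_inverse C", OF assms])
    (rule moore_penrose_inverse_unique[OF _ assms])

text \<open>For a surjective \<open>C\<close> the matrix \<open>C C\<^sup>T\<close> is invertible, and the pseudoinverse is
  \<open>C\<^sup>T (C C\<^sup>T)\<^sup>-\<^sup>1\<close>.\<close>

lemma mult_pinv_surj:
  fixes C :: "real mat"
  assumes C: "C \<in> carrier_mat n k"
    and surj: "\<And>y. y \<in> carrier_vec n \<Longrightarrow> \<exists>v\<in>carrier_vec k. C *\<^sub>v v = y"
  shows "pinv C \<in> carrier_mat k n" and "C * pinv C = 1\<^sub>m n"
proof -
  let ?W = "C * C\<^sup>T"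
  have Ct: "C\<^sup>T \<in> carrier_mat k n" and W: "?W \<in> carrier_mat n n" using C by auto
  \<comment> \<open>Triviality of the kernel of \<open>?W\<close>: with \<open>?z\<close> the
    transpose of \<open>C\<close> applied to \<open>y\<close>, \<open>?z \<bullet> ?z\<close> equals
    the product of \<open>y\<close> with \<open>?W\<close> applied to \<open>y\<close>, which is 0,
    so \<open>?z\<close> vanishes. Writing \<open>y\<close> as the image of some \<open>v\<close>
    under \<open>C\<close> then gives \<open>y \<bullet> y = ?z \<bullet> v = 0\<close>.\<close>
  have "y = 0\<^sub>v n" if y: "y \<in> carrier_vec n" and Wy: "?W *\<^sub>v y = 0\<^sub>v n" for y
  proof -
    let ?z = "C\<^sup>T *\<^sub>v y"
    have z: "?z \<in> carrier_vec k" using Ct y by simp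
    have "?z \<bullet> ?z = y \<bullet> (C *\<^sub>v ?z)"
      using transpose_vec_mult_scalar[OF C z y] by simp
    also have "C *\<^sub>v ?z = 0\<^sub>v n" using Wy C Ct y by simp
    finally have z0: "?z = 0\<^sub>v k" using z y by (intro real_scalar_prod_self_eq_0) auto
    obtain v where v: "v \<in> carrier_vec k" "C *\<^sub>v v = y" using surj[OF y] by blast
    have "y \<bullet> y = ?z \<bullet> v" using transpose_vec_mult_scalar[OF C v(1) y] v(2) by simp
    then show "y = 0\<^sub>v n" using z0 v y by (intro real_scalar_prod_self_eq_0) auto
  qed
  then have "det ?W \<noteq> 0" using det_0_iff_vec_prod_zero[OF W] by auto
  from det_non_zero_imp_unit[OF W this, of "()"]
  obtain V where V: "V \<in> carrier_mat n n" and VW: "V * ?W = 1\<^sub>m n" and WV: "?W * V = 1\<^sub>m n"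
    by (auto simp: Units_def ring_mat_simps)
  \<comment> \<open>The transpose of \<open>V\<close> is also a left inverse of the symmetric matrix
    \<open>?W\<close>, hence equals \<open>V\<close>. The fourth Penrose condition rests on this
    symmetry.\<close>
  have "?W\<^sup>T = ?W" using C by (simp add: transpose_mult[OF C Ct])
  then have "V\<^sup>T * ?W = 1\<^sub>m n" using arg_cong[OF WV, of transpose_mat] transpose_mult[OF W V] by simp
  then have "V\<^sup>T * (?W * V) = V"
    using V W by (simp add: assoc_mult_mat[symmetric, of "V\<^sup>T" n n ?W n V n])
  then have V_sym: "V\<^sup>T = V" using V WV by simp
  let ?P = "C\<^sup>T * V"
  have P: "?P \<in> carrier_mat k n" using Ct V by simp
  have CP: "C * ?P = 1\<^sub>m n" using WV C Ct V by (simp add: assoc_mult_mat[OF C Ct V])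
  have "(?P * C)\<^sup>T = C\<^sup>T * (V\<^sup>T * C)"
    using transpose_mult[OF P C] transpose_mult[OF Ct V] by simp
  also have "\<dots> = ?P * C" using C Ct V V_sym by (simp add: assoc_mult_mat[OF Ct V C])
  finally have PC: "(?P * C)\<^sup>T = ?P * C" .
  \<comment> \<open>Since \<open>C * ?P\<close> is the identity, the first three Penrose conditions
    are immediate; the fourth is \<open>PC\<close>.\<close>
  have "moore_penrose_inverse C ?P"
    unfolding moore_penrose_inverse_def assoc_mult_mat[OF P C P] CP PC
    using C right_mult_one_mat[OF P] P by simp
  then show "pinv C \<in> carrier_mat k n" "C * pinv C = 1\<^sub>m n" using pinv_eq P CP by auto
qed

section \<open>Stacked vectors and block matrices\<close>

lemma append_vec_assoc: "(u @\<^sub>v v) @\<^sub>v w = u @\<^sub>v v @\<^sub>v w"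
  by (rule eq_vecI) (auto simp: less_diff_conv)

lemma append_vNil [simp]: "v @\<^sub>v vNil = v"
  by (rule eq_vecI) auto

lemma stack_Nil [simp]: "stack [] = vNil"
  and stack_Cons [simp]: "stack (v # vs) = v @\<^sub>v stack vs"
  by (simp_all add: stack_def)

lemma append_cols_carrier [simp]:
  "A \<in> carrier_mat nr nc \<Longrightarrow> B \<in> carrier_mat nr nc' \<Longrightarrow> append_cols A B \<in> carrier_mat nr (nc + nc')"
  unfolding append_cols_def by (auto simp: four_block_mat_def Let_def)

lemma append_cols_mult_append_vec:
  assumes "A \<in> carrier_mat nr nc" "B \<in> carrier_mat nr nc'"
    and "v \<in> carrier_vec nc" "w \<in> carrier_vec nc'"
  shows "append_cols A B *\<^sub>v (v @\<^sub>v w) = A *\<^sub>v v + B *\<^sub>v (w :: 'a :: comm_ring_1 vec)"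
proof -
  have "append_cols A B *\<^sub>v (v @\<^sub>v w)
      = (A *\<^sub>v v + B *\<^sub>v w) @\<^sub>v (0\<^sub>m 0 nc *\<^sub>v v + 0\<^sub>m 0 nc' *\<^sub>v w)"
    using assms four_block_mat_mult_vec[of A nr nc B nc' "0\<^sub>m 0 nc" 0 "0\<^sub>m 0 nc'" v w]
    by (simp add: append_cols_def)
  also have "0\<^sub>m 0 nc *\<^sub>v v + 0\<^sub>m 0 nc' *\<^sub>v w = 0\<^sub>v 0" by (rule eq_vecI) auto
  finally show ?thesis using assms by simp
qed

lemma block_col_carrier:
  assumes "\<forall>C\<in>set Cs. dim_col C = nc"
  shows "block_col nc Cs \<in> carrier_mat (\<Sum>C\<leftarrow>Cs. dim_row C) nc"
  using assms
proof (induction Cs)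
  case (Cons C Cs)
  have "C \<in> carrier_mat (dim_row C) nc" using Cons.prems by auto
  moreover have "block_col nc Cs \<in> carrier_mat (\<Sum>C\<leftarrow>Cs. dim_row C) nc"
    using Cons.IH Cons.prems by simp
  ultimately have "C @\<^sub>r block_col nc Cs \<in> carrier_mat (dim_row C + (\<Sum>C\<leftarrow>Cs. dim_row C)) nc"
    by (rule carrier_append_rows)
  then show ?case by (simp only: block_col_def foldr.simps o_def list.map sum_list.Cons)
qed (simp add: block_col_def)

lemma block_col_mult_vec:
  fixes v :: "'a :: comm_ring_1 vec"
  assumes "\<forall>C\<in>set Cs. dim_col C = nc" and v: "v \<in> carrier_vec nc"
  shows "block_col nc Cs *\<^sub>v v = stack (map (\<lambda>C. C *\<^sub>v v) Cs)"
  using assms(1)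
proof (induction Cs)
  case Nil
  show ?case by (rule eq_vecI) (auto simp: block_col_def)
next
  case (Cons C Cs)
  have C: "C \<in> carrier_mat (dim_row C) nc" and Cs: "\<forall>C\<in>set Cs. dim_col C = nc"
    using Cons.prems by auto
  have "block_col nc (C # Cs) = C @\<^sub>r block_col nc Cs" by (simp add: block_col_def)
  then show ?case
    by (simp only: mat_mult_append[OF C block_col_carrier[OF Cs] v] Cons.IH[OF Cs] list.map stack_Cons)
qed

text \<open>The value of a block row is a sum that starts with the rightmost block \<open>D\<close>
  and grows to the left. Given a guess \<open>y\<close> for the partial sums, it suffices to check
  the start and one increment at a time; this serves the rows of both \<open>G\<close> and
  \<open>H\<close>.\<close>

lemma block_row_partial_sums:
  fixes z :: "'a :: comm_ring_1 vec"
  assumes "\<forall>i\<in>{1..l}. F i \<in> carrier_mat nr (q i) \<and> a i \<in> carrier_vec (q i)"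
    and D: "D \<in> carrier_mat nr n" and z: "z \<in> carrier_vec n"
    and y0: "y 0 = D *\<^sub>v z"
    and "\<forall>i<l. y (Suc i) = F (Suc i) *\<^sub>v a (Suc i) + y i"
  shows "block_row nr (map F (rev [1..<Suc l]) @ [D]) \<in> carrier_mat nr ((\<Sum>i = 1..l. q i) + n)
    \<and> stack (map a (rev [1..<Suc l]) @ [z]) \<in> carrier_vec ((\<Sum>i = 1..l. q i) + n)
    \<and> block_row nr (map F (rev [1..<Suc l]) @ [D]) *\<^sub>v stack (map a (rev [1..<Suc l]) @ [z]) = y l"
  using assms(1,5)
proof (induction l)
  case 0
  \<comment> \<open>The fold over the blocks ends in a matrix of width 0, which contributes a zero
    summand.\<close>
  have "append_cols D (0\<^sub>m nr 0) *\<^sub>v (z @\<^sub>v 0\<^sub>v 0) = D *\<^sub>v z + 0\<^sub>m nr 0 *\<^sub>v 0\<^sub>v 0"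
    using D z by (intro append_cols_mult_append_vec[where nc = n and nc' = 0]) auto
  then have "append_cols D (0\<^sub>m nr 0) *\<^sub>v z = y 0" using D z y0 by auto
  then show ?case using z append_cols_carrier[OF D, of "0\<^sub>m nr 0" 0]
    by (simp add: block_row_def)
next
  case (Suc l)
  let ?R = "block_row nr (map F (rev [1..<Suc l]) @ [D])"
  let ?s = "stack (map a (rev [1..<Suc l]) @ [z])"
  have row: "block_row nr (map F (rev [1..<Suc (Suc l)]) @ [D]) = append_cols (F (Suc l)) ?R"
    by (simp add: block_row_def)
  have st: "stack (map a (rev [1..<Suc (Suc l)]) @ [z]) = a (Suc l) @\<^sub>v ?s" by simp
  have IH: "?R \<in> carrier_mat nr ((\<Sum>i = 1..l. q i) + n)" 
    "?s \<in> carrier_vec ((\<Sum>i = 1..l. q i) + n)" "?R *\<^sub>v ?s = y l"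
    using Suc.IH Suc.prems by auto
  have F: "F (Suc l) \<in> carrier_mat nr (q (Suc l))" and a: "a (Suc l) \<in> carrier_vec (q (Suc l))"
    using Suc.prems by auto
  have dim: "(\<Sum>i = 1..Suc l. q i) + n = q (Suc l) + ((\<Sum>i = 1..l. q i) + n)" by simp
  show ?case unfolding row st dim
    using append_cols_carrier[OF F IH(1)] append_carrier_vec[OF a IH(2)] 
      append_cols_mult_append_vec[OF F IH(1) a IH(2)] IH(3) Suc.prems(2) by simp
qed

section \<open>Descending products and the matrices \<open>G\<close> and \<open>H\<close>\<close>

lemma desc_prod_self [simp]: "desc_prod n Q j j = 1\<^sub>m n"
  by (simp add: desc_prod_def)

lemma desc_prod_carrier:
  assumes "\<forall>i\<in>{1..j}. Q i \<in> carrier_mat n n"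
  shows "desc_prod n Q i j \<in> carrier_mat n n"
proof -
  have "foldr (*) Cs (1\<^sub>m n) \<in> carrier_mat n n" if "set Cs \<subseteq> carrier_mat n n" for Cs :: "real mat list"
    using that by (induction Cs) auto
  moreover have "set (map Q (rev [Suc i..<Suc j])) \<subseteq> carrier_mat n n" using assms by auto
  ultimately show ?thesis unfolding desc_prod_def by blast
qed

text \<open>The fold unfolds a product at its left end, but the telescoping in \<open>H\<close>
  consumes the rightmost factor: \<open>Q (Suc i)\<close> is the factor next to
  \<open>z i\<close>.\<close>

lemma desc_prod_step:
  assumes Q: "\<forall>i\<in>{1..j}. Q i \<in> carrier_mat n n" and ij: "i < j"
  shows "desc_prod n Q i j = desc_prod n Q (Suc i) j * Q (Suc i)"
proof -
  \<comment> \<open>The initial value of the fold is generalised to any \<open>D\<close>, which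
    associativity moves out to the right.\<close>
  have *: "foldr (*) Cs D \<in> carrier_mat n n \<and> foldr (*) Cs D = foldr (*) Cs (1\<^sub>m n) * D"
    if "set Cs \<subseteq> carrier_mat n n" "D \<in> carrier_mat n n" for Cs and D :: "real mat"
    using that
  proof (induction Cs)
    case (Cons C Cs)
    have "foldr (*) Cs (1\<^sub>m n) \<in> carrier_mat n n"
      using Cons.prems by (induction Cs) auto
    then show ?case using Cons assoc_mult_mat[of C n n "foldr (*) Cs (1\<^sub>m n)" n D n] by auto
  qed simp
  have Qi: "Q (Suc i) \<in> carrier_mat n n" using Q ij by simp
  let ?Qs = "map Q (rev [Suc (Suc i)..<Suc j])"
  have "desc_prod n Q i j = foldr (*) ?Qs (Q (Suc i))"
    using ij right_mult_one_mat[OF Qi] by (simp add: desc_prod_def upt_conv_Cons del: upt_Suc)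
  also have "set ?Qs \<subseteq> carrier_mat n n" using Q by auto
  then have "foldr (*) ?Qs (Q (Suc i)) = foldr (*) ?Qs (1\<^sub>m n) * Q (Suc i)" using * Qi by blast
  finally show ?thesis by (simp only: desc_prod_def)
qed

text \<open>Both block products telescope: the partial sums of block row \<open>j\<close> of \<open>H\<close> are
  \<open>Q\<^sub>j \<cdots> Q\<^sub>i\<^sub>+\<^sub>1 z\<^sub>i\<close>.\<close>

lemma G_H_mult_vec:
  fixes z :: "nat \<Rightarrow> real vec"
  assumes Ut: "\<forall>i\<in>{1..l}. Ut i \<in> carrier_mat (r i) (q i)"
    and Xt: "\<forall>i\<in>{1..l}. Xt i \<in> carrier_mat n (q i)"
    and Q: "\<forall>i\<in>{1..l}. Q i \<in> carrier_mat n n"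
    and a: "\<forall>i\<in>{1..l}. a i \<in> carrier_vec (q i)"
    and z0: "z 0 \<in> carrier_vec n"
    and z_Suc: "\<forall>i<l. z (Suc i) = Q (Suc i) *\<^sub>v z i + Xt (Suc i) *\<^sub>v a (Suc i)"
  defines "\<alpha> \<equiv> stack (map a (rev [1..<Suc l]) @ [z 0])"
  shows "\<alpha> \<in> carrier_vec ((\<Sum>i = 1..l. q i) + n)"
    and "(G_mat n l Ut @\<^sub>r H_mat n l Xt Q) *\<^sub>v \<alpha>
      = stack (map (\<lambda>i. Ut i *\<^sub>v a i) (rev [1..<Suc l])) @\<^sub>v stack (map z [0..<Suc l])"
proof -
  let ?d = "(\<Sum>i = 1..l. q i) + n"
  let ?g = "\<lambda>i j. if j = i then Ut i else 0\<^sub>m (dim_row (Ut i)) (dim_col (Ut j))"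
  let ?h = "\<lambda>j i. if i \<le> j then desc_prod n Q i j * Xt i else 0\<^sub>m n (dim_col (Xt i))"
  let ?G = "\<lambda>i. block_row (dim_row (Ut i)) (map (?g i) (rev [1..<Suc l]) @ [0\<^sub>m (dim_row (Ut i)) n])"
  let ?H = "\<lambda>j. block_row n (map (?h j) (rev [1..<Suc l]) @ [desc_prod n Q 0 j])"
  have z: "z i \<in> carrier_vec n" if "i \<le> l" for i
    using that
  proof (induction i)
    case (Suc i)
    then have "Q (Suc i) *\<^sub>v z i \<in> carrier_vec n" "Xt (Suc i) *\<^sub>v a (Suc i) \<in> carrier_vec n"
      using Q Xt a by (auto intro!: mult_mat_vec_carrier)
    then show ?case using z_Suc Suc.prems by simp
  qed (use z0 in simp)
  have desc: "desc_prod n Q i j \<in> carrier_mat n n" if "j \<le> l" for i j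
    using desc_prod_carrier[of j Q n i] Q that by auto
  have G: "?G i \<in> carrier_mat (r i) ?d \<and> \<alpha> \<in> carrier_vec ?d \<and> ?G i *\<^sub>v \<alpha> = Ut i *\<^sub>v a i"
    if i: "i \<in> {1..l}" for i
  proof -
    \<comment> \<open>Only block \<open>i\<close> of this row is nonzero, so the partial sum jumps
      once, at \<open>j = i\<close>, and is constant afterwards.\<close>
    let ?y = "\<lambda>j. if j < i then 0\<^sub>v (r i) else Ut i *\<^sub>v a i"
    have Ui: "Ut i \<in> carrier_mat (r i) (q i)" and ai: "a i \<in> carrier_vec (q i)" using Ut a i by auto
    have "?y (Suc j) = ?g i (Suc j) *\<^sub>v a (Suc j) + ?y j" if "j < l" for j
    proof -
      have "Ut (Suc j) \<in> carrier_mat (r (Suc j)) (q (Suc j))" "a (Suc j) \<in> carrier_vec (q (Suc j))"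
        using Ut a that by auto
      then show ?thesis using Ui ai by (cases "j < i"; cases "Suc j < i") (auto simp: not_less_eq less_Suc_eq)
    qed
    moreover have "\<forall>j\<in>{1..l}. ?g i j \<in> carrier_mat (r i) (q j) \<and> a j \<in> carrier_vec (q j)"
      using Ut a Ui by auto
    moreover have "?y 0 = 0\<^sub>m (r i) n *\<^sub>v z 0" using i z0 by auto
    ultimately have "block_row (r i) (map (?g i) (rev [1..<Suc l]) @ [0\<^sub>m (r i) n]) \<in> carrier_mat (r i) ?d
      \<and> \<alpha> \<in> carrier_vec ?d
      \<and> block_row (r i) (map (?g i) (rev [1..<Suc l]) @ [0\<^sub>m (r i) n]) *\<^sub>v \<alpha> = ?y l"
      unfolding \<alpha>_def using z0 by (intro block_row_partial_sums) simp_all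
    moreover have "dim_row (Ut i) = r i" "?y l = Ut i *\<^sub>v a i" using Ui i by auto
    ultimately show ?thesis by metis
  qed
  have H: "?H j \<in> carrier_mat n ?d \<and> \<alpha> \<in> carrier_vec ?d \<and> ?H j *\<^sub>v \<alpha> = z j"
    if j: "j \<le> l" for j
  proof -
    \<comment> \<open>Blocks with index above \<open>j\<close> are zero, so the sum stays at
      \<open>z j\<close> from \<open>i = j\<close> on, where the descending product is the identity.
      At \<open>i = 0\<close> it is the contribution of the last block.\<close>
    let ?y = "\<lambda>i. if i \<le> j then desc_prod n Q i j *\<^sub>v z i else z j"
    have "?y (Suc i) = ?h j (Suc i) *\<^sub>v a (Suc i) + ?y i" if "i < l" for i
    proof -
      have Xi: "Xt (Suc i) \<in> carrier_mat n (q (Suc i))" and ai: "a (Suc i) \<in> carrier_vec (q (Suc i))"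
        and Qi: "Q (Suc i) \<in> carrier_mat n n" and zi: "z i \<in> carrier_vec n"
        using Xt a Q z that by auto
      consider "i < j" | "i = j" | "j < i" by linarith
      then show ?thesis
      proof cases
        case 1
        let ?D = "desc_prod n Q (Suc i) j"
        have D: "?D \<in> carrier_mat n n" by (rule desc[OF j])
        have XaC: "Xt (Suc i) *\<^sub>v a (Suc i) \<in> carrier_vec n"
          and QzC: "Q (Suc i) *\<^sub>v z i \<in> carrier_vec n"
          using Xi ai Qi zi by auto
        \<comment> \<open>Expanding \<open>z (Suc i)\<close> by its recursion splits the new partial
          sum into the old one, whose product absorbs \<open>Q (Suc i)\<close>, and the summand of
          block \<open>Suc i\<close>.\<close>
        have "?D *\<^sub>v z (Suc i) = ?D *\<^sub>v (Q (Suc i) *\<^sub>v z i) + ?D *\<^sub>v (Xt (Suc i) *\<^sub>v a (Suc i))"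
          using z_Suc that mult_add_distrib_mat_vec[OF D QzC XaC] by simp
        also have "?D *\<^sub>v (Q (Suc i) *\<^sub>v z i) = desc_prod n Q i j *\<^sub>v z i"
          using desc_prod_step[of j Q n i] Q j 1 assoc_mult_mat_vec[OF D Qi zi] by auto
        also have "?D *\<^sub>v (Xt (Suc i) *\<^sub>v a (Suc i)) = (?D * Xt (Suc i)) *\<^sub>v a (Suc i)"
          by (rule assoc_mult_mat_vec[OF D Xi ai, symmetric])
        finally show ?thesis
          using 1 comm_add_vec[of "desc_prod n Q i j *\<^sub>v z i" n "(?D * Xt (Suc i)) *\<^sub>v a (Suc i)"]
            desc[OF j, of i] zi D Xi ai by auto
      next
        case 2
        then show ?thesis using Xi ai zi by auto
      next
        case 3
        then show ?thesis using Xi ai z[OF j] by auto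
      qed
    qed
    moreover have "\<forall>i\<in>{1..l}. ?h j i \<in> carrier_mat n (q i) \<and> a i \<in> carrier_vec (q i)"
      using Xt a mult_carrier_mat[OF desc[OF j]] by auto
    moreover have "?y l = z j" using j z[OF j] by auto
    moreover have "?H j \<in> carrier_mat n ?d \<and> \<alpha> \<in> carrier_vec ?d \<and> ?H j *\<^sub>v \<alpha> = ?y l"
      unfolding \<alpha>_def using calculation desc[OF j] z0 by (intro block_row_partial_sums) simp_all
    ultimately show ?thesis by simp
  qed
  \<comment> \<open>Block row 0 of \<open>H\<close> exists even for \<open>l = 0\<close>, when
    \<open>G\<close> has no block rows.\<close>
  show \<alpha>: "\<alpha> \<in> carrier_vec ?d" using H[of 0] by simp
  define Gb Hb where "Gb = ?G" and "Hb = ?H"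
  have Gb: "Gb i \<in> carrier_mat (r i) ?d" "Gb i *\<^sub>v \<alpha> = Ut i *\<^sub>v a i" if "i \<in> {1..l}" for i
    using G[OF that] by (simp_all only: Gb_def)
  have Hb: "Hb j \<in> carrier_mat n ?d" "Hb j *\<^sub>v \<alpha> = z j" if "j \<le> l" for j
    using H[OF that] by (simp_all only: Hb_def)
  have Gs: "\<forall>C\<in>set (map Gb (rev [1..<Suc l])). dim_col C = ?d"
    using carrier_matD(2)[OF Gb(1)] by (auto simp del: upt_Suc)
  have Hs: "\<forall>C\<in>set (map Hb [0..<Suc l]). dim_col C = ?d"
    using carrier_matD(2)[OF Hb(1)] by (auto simp del: upt_Suc)
  have dims: "(\<Sum>i = 1..l. dim_col (Ut i)) = (\<Sum>i = 1..l. q i)"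
    "(\<Sum>i = 1..l. dim_col (Xt i)) = (\<Sum>i = 1..l. q i)"
    using Ut Xt by (auto intro!: sum.cong)
  have GH: "G_mat n l Ut = block_col ?d (map Gb (rev [1..<Suc l]))"
    "H_mat n l Xt Q = block_col ?d (map Hb [0..<Suc l])"
    by (simp_all only: G_mat_def H_mat_def dims Gb_def Hb_def)
  have "(G_mat n l Ut @\<^sub>r H_mat n l Xt Q) *\<^sub>v \<alpha> = (G_mat n l Ut *\<^sub>v \<alpha>) @\<^sub>v (H_mat n l Xt Q *\<^sub>v \<alpha>)"
    unfolding GH by (rule mat_mult_append[OF block_col_carrier[OF Gs] block_col_carrier[OF Hs] \<alpha>])
  also have "G_mat n l Ut *\<^sub>v \<alpha> = stack (map (\<lambda>i. Ut i *\<^sub>v a i) (rev [1..<Suc l]))"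
    unfolding GH block_col_mult_vec[OF Gs \<alpha>] map_map
    using Gb(2) by (intro arg_cong[of _ _ stack] map_cong) (auto simp del: upt_Suc)
  also have "H_mat n l Xt Q *\<^sub>v \<alpha> = stack (map z [0..<Suc l])"
    unfolding GH block_col_mult_vec[OF Hs \<alpha>] map_map
    using Hb(2) by (intro arg_cong[of _ _ stack] map_cong) (auto simp del: upt_Suc)
  finally show "(G_mat n l Ut @\<^sub>r H_mat n l Xt Q) *\<^sub>v \<alpha>
      = stack (map (\<lambda>i. Ut i *\<^sub>v a i) (rev [1..<Suc l])) @\<^sub>v stack (map z [0..<Suc l])" .
qed

section \<open>Inputs, states and data over one segment\<close>

lemma input_stack_Suc: "input_stack u (Suc t) = u t @\<^sub>v input_stack u t"
  by (simp add: input_stack_def)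

lemma input_stack_carrier:
  assumes "\<forall>s<t. u s \<in> carrier_vec m"
  shows "input_stack u t \<in> carrier_vec (m * t)"
  using assms
proof (induction t)
  case (Suc t)
  then have "u t @\<^sub>v input_stack u t \<in> carrier_vec (m + m * t)"
    by (intro append_carrier_vec) auto
  then show ?case by (simp add: input_stack_Suc)
qed (simp add: input_stack_def)

text \<open>Reversed time order puts the later inputs on top; this is why the blocks of
  \<open>G\<close> run from \<open>l\<close> down to 1.\<close>

lemma input_stack_add:
  "input_stack u (s + t) = input_stack (\<lambda>r. u (s + r)) t @\<^sub>v input_stack u s"
  by (induction t) (simp_all add: input_stack_Suc append_vec_assoc, simp add: input_stack_def)

text \<open>Time invariance: each stretch between two sampling times can be treated as a run of its
  own, started at the earlier sample.\<close>

lemma state_add: "state A B x u (s + t) = state A B (state A B x u s) (\<lambda>r. u (s + r)) t"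
  by (induction t) simp_all

lemma state_carrier:
  assumes "A \<in> carrier_mat n n" "B \<in> carrier_mat n m" "x \<in> carrier_vec n"
    and "\<forall>s<t. u s \<in> carrier_vec m"
  shows "state A B x u t \<in> carrier_vec n"
  using assms(4)
proof (induction t)
  case (Suc t)
  then have "A *\<^sub>v state A B x u t \<in> carrier_vec n" "B *\<^sub>v u t \<in> carrier_vec n"
    using assms by (auto intro!: mult_mat_vec_carrier)
  then show ?case by simp
qed (use assms in simp)

text \<open>Here \<open>P = A\<^sup>t\<close>, and \<open>C\<close> is the \<open>t\<close>-steps controllability matrix.\<close>

lemma state_affine:
  assumes A: "A \<in> carrier_mat n n" and B: "B \<in> carrier_mat n m"
  shows "\<exists>P\<in>carrier_mat n n. \<exists>C\<in>carrier_mat n (m * t). \<forall>x\<in>carrier_vec n. \<forall>u.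
    (\<forall>s<t. u s \<in> carrier_vec m) \<longrightarrow> state A B x u t = P *\<^sub>v x + C *\<^sub>v input_stack u t"
proof (induction t)
  case 0
  have "x = 1\<^sub>m n *\<^sub>v x + 0\<^sub>m n 0 *\<^sub>v vNil" if "x \<in> carrier_vec n" for x :: "real vec"
    using that by (intro eq_vecI) auto
  then show ?case
    by (intro bexI[of _ "1\<^sub>m n"] bexI[of _ "0\<^sub>m n 0"]) (auto simp: input_stack_def)
next
  case (Suc t)
  then obtain P C where P: "P \<in> carrier_mat n n" and C: "C \<in> carrier_mat n (m * t)"
    and IH: "\<And>x u. x \<in> carrier_vec n \<Longrightarrow> \<forall>s<t. u s \<in> carrier_vec m \<Longrightarrow>
      state A B x u t = P *\<^sub>v x + C *\<^sub>v input_stack u t" by blast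
  \<comment> \<open>The witnesses for the next horizon are \<open>A * P\<close> and
    \<open>append_cols B (A * C)\<close>. \<open>B\<close> is leftmost because the newest input is
    on top of the stack.\<close>
  have AP: "A * P \<in> carrier_mat n n" and AC: "A * C \<in> carrier_mat n (m * t)" using A P C by auto
  have ABC: "append_cols B (A * C) \<in> carrier_mat n (m * Suc t)"
    using append_cols_carrier[OF B AC] by simp
  have "state A B x u (Suc t) = (A * P) *\<^sub>v x + append_cols B (A * C) *\<^sub>v input_stack u (Suc t)"
    if x: "x \<in> carrier_vec n" and u: "\<forall>s<Suc t. u s \<in> carrier_vec m" for x u
  proof -
    have ut: "u t \<in> carrier_vec m" and us: "\<forall>s<t. u s \<in> carrier_vec m" using u by auto
    have w: "input_stack u t \<in> carrier_vec (m * t)" by (rule input_stack_carrier[OF us])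
    have Px: "P *\<^sub>v x \<in> carrier_vec n" and Cw: "C *\<^sub>v input_stack u t \<in> carrier_vec n"
      and Bu: "B *\<^sub>v u t \<in> carrier_vec n" and APx: "(A * P) *\<^sub>v x \<in> carrier_vec n"
      and ACw: "(A * C) *\<^sub>v input_stack u t \<in> carrier_vec n"
      using P C B AP AC x w ut by (auto intro: mult_mat_vec_carrier)
    have "state A B x u (Suc t) = A *\<^sub>v (P *\<^sub>v x + C *\<^sub>v input_stack u t) + B *\<^sub>v u t"
      using IH[OF x us] by simp
    also have "\<dots> = (A * P) *\<^sub>v x + (A * C) *\<^sub>v input_stack u t + B *\<^sub>v u t"
      by (simp only: mult_add_distrib_mat_vec[OF A Px Cw] assoc_mult_mat_vec[OF A P x]
          assoc_mult_mat_vec[OF A C w])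
    also have "\<dots> = (A * P) *\<^sub>v x + (B *\<^sub>v u t + (A * C) *\<^sub>v input_stack u t)"
      by (simp only: assoc_add_vec[OF APx ACw Bu] comm_add_vec[OF ACw Bu])
    also have "B *\<^sub>v u t + (A * C) *\<^sub>v input_stack u t
        = append_cols B (A * C) *\<^sub>v input_stack u (Suc t)"
      unfolding input_stack_Suc by (rule append_cols_mult_append_vec[OF B AC ut w, symmetric])
    finally show ?thesis .
  qed
  then show ?case using AP ABC by blast
qed

text \<open>Full row rank lets one prescribe \<open>X\<^sub>0 v\<close> and \<open>U v\<close> independently. With \<open>X\<^sub>0 v = 0\<close> this gives
  the coefficients \<open>a\<close>; with \<open>U v = 0\<close> it makes \<open>X\<^sub>0 K\<^sub>U\<close> right invertible, so that \<open>Q = A\<^sup>t\<close>.\<close>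

lemma experiment_data_segment:
  assumes A: "A \<in> carrier_mat n n" and B: "B \<in> carrier_mat n m"
    and data: "experiment_data n m A B t N U X0 X"
    and rank: "full_row_rank (X0 @\<^sub>r U)"
    and KX: "kernel_basis_matrix X0 KX" and KU: "kernel_basis_matrix U KU"
  defines "Q \<equiv> X * KU * pinv (X0 * KU)"
  shows "Q \<in> carrier_mat n n"
    and "\<lbrakk>x \<in> carrier_vec n; \<forall>s<t. u s \<in> carrier_vec m\<rbrakk> \<Longrightarrow>
      \<exists>a\<in>carrier_vec (dim_col KX). input_stack u t = (U * KX) *\<^sub>v a \<and>
        state A B x u t = Q *\<^sub>v x + (X * KX) *\<^sub>v a"
proof -
  have U: "U \<in> carrier_mat (m * t) N" and X0: "X0 \<in> carrier_mat n N" and X: "X \<in> carrier_mat n N"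
    and cols: "\<And>j. j < N \<Longrightarrow> \<exists>u. (\<forall>s<t. u s \<in> carrier_vec m) \<and> col U j = input_stack u t \<and>
      col X j = state A B (col X0 j) u t"
    using data by (auto simp: experiment_data_def)
  have KXc: "KX \<in> carrier_mat N (dim_col KX)" and KUc: "KU \<in> carrier_mat N (dim_col KU)"
    using KX KU X0 U by (auto simp: kernel_basis_matrix_def)
  obtain P C where P: "P \<in> carrier_mat n n" and C: "C \<in> carrier_mat n (m * t)"
    and PC: "\<And>x u. x \<in> carrier_vec n \<Longrightarrow> \<forall>s<t. u s \<in> carrier_vec m \<Longrightarrow>
      state A B x u t = P *\<^sub>v x + C *\<^sub>v input_stack u t"
    using state_affine[OF A B, of t] by blast
  have PX0: "P * X0 \<in> carrier_mat n N" and CU: "C * U \<in> carrier_mat n N" using P X0 C U by auto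
  \<comment> \<open>\<open>P\<close> and \<open>C\<close> depend on the horizon alone, so the same
    pair serves every experiment and the identity can be checked column by column.\<close>
  have X_eq: "X = P * X0 + C * U"
  proof (rule mat_col_eqI)
    fix j assume "j < dim_col (P * X0 + C * U)"
    then have j: "j < N" using U by simp
    then obtain u where u: "\<forall>s<t. u s \<in> carrier_vec m" "col U j = input_stack u t"
      "col X j = state A B (col X0 j) u t" using cols by blast
    have "col X j = P *\<^sub>v col X0 j + C *\<^sub>v col U j" using u PC[of "col X0 j" u] X0 by auto
    also have "\<dots> = col (P * X0) j + col (C * U) j"
      by (simp only: col_mult2[OF P X0 j] col_mult2[OF C U j])
    also have "\<dots> = col (P * X0 + C * U) j" using PX0 CU j by (simp add: col_add)
    finally show "col X j = col (P * X0 + C * U) j" .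
  qed (use X CU in auto)
  \<comment> \<open>A preimage of \<open>y\<close> stacked on \<open>w\<close> under the full-rank
    matrix splits into the two required equations.\<close>
  have surj: "\<exists>v\<in>carrier_vec N. X0 *\<^sub>v v = y \<and> U *\<^sub>v v = w"
    if y: "y \<in> carrier_vec n" and w: "w \<in> carrier_vec (m * t)" for y w
  proof -
    have XU: "X0 @\<^sub>r U \<in> carrier_mat (n + m * t) N" by (rule carrier_append_rows[OF X0 U])
    have "y @\<^sub>v w \<in> carrier_vec (n + m * t)" using y w by (rule append_carrier_vec)
    then obtain v where v: "v \<in> carrier_vec N" "(X0 @\<^sub>r U) *\<^sub>v v = y @\<^sub>v w"
      using full_row_rank_surj[OF rank, of "y @\<^sub>v w"] XU by auto
    then have "X0 *\<^sub>v v @\<^sub>v U *\<^sub>v v = y @\<^sub>v w" using mat_mult_append[OF X0 U v(1)] by simp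
    moreover have "X0 *\<^sub>v v \<in> carrier_vec n" using X0 v(1) by auto
    ultimately show ?thesis using append_vec_eq[of _ n] y v(1) by blast
  qed
  let ?Y = "X0 * KU"
  have Y: "?Y \<in> carrier_mat n (dim_col KU)" by (rule mult_carrier_mat[OF X0 KUc])
  have "\<exists>b\<in>carrier_vec (dim_col KU). ?Y *\<^sub>v b = y" if y: "y \<in> carrier_vec n" for y
  proof -
    obtain v where v: "v \<in> carrier_vec N" "X0 *\<^sub>v v = y" "U *\<^sub>v v = 0\<^sub>v (m * t)"
      using surj[OF y, of "0\<^sub>v (m * t)"] by auto
    then obtain b where b: "b \<in> carrier_vec (dim_col KU)" "KU *\<^sub>v b = v"
      using kernel_basis_matrix_surj[OF KU, of v] U by auto
    then have "?Y *\<^sub>v b = y" using v assoc_mult_mat_vec[OF X0 KUc b(1)] by simp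
    then show ?thesis using b(1) by blast
  qed
  note pinv = mult_pinv_surj[OF Y this]
  \<comment> \<open>Multiplying \<open>X_eq\<close> by \<open>KU\<close> leaves only
    \<open>P * ?Y\<close>, and \<open>pinv ?Y\<close> is a right inverse of \<open>?Y\<close>, so
    \<open>Q\<close> recovers \<open>P\<close>.\<close>
  have "X * KU = P * ?Y + C * (U * KU)"
    unfolding X_eq by (simp only: add_mult_distrib_mat[OF PX0 CU KUc]
        assoc_mult_mat[OF P X0 KUc] assoc_mult_mat[OF C U KUc])
  also have "U * KU = 0\<^sub>m (m * t) (dim_col KU)"
    using mult_kernel_basis_matrix[OF KU] U by simp
  also have "P * ?Y + C * 0\<^sub>m (m * t) (dim_col KU) = P * ?Y"
    using mult_carrier_mat[OF P Y] right_mult_zero_mat[OF C] by simp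
  finally have "Q = P * (?Y * pinv ?Y)"
    unfolding Q_def by (simp only: assoc_mult_mat[OF P Y pinv(1)])
  then have Q: "Q = P" using pinv(2) right_mult_one_mat[OF P] by simp
  then show "Q \<in> carrier_mat n n" using P by simp
  show "\<exists>a\<in>carrier_vec (dim_col KX). input_stack u t = (U * KX) *\<^sub>v a \<and>
      state A B x u t = Q *\<^sub>v x + (X * KX) *\<^sub>v a"
    if x: "x \<in> carrier_vec n" and u: "\<forall>s<t. u s \<in> carrier_vec m"
  proof -
    let ?w = "input_stack u t"
    have w: "?w \<in> carrier_vec (m * t)" by (rule input_stack_carrier[OF u])
    obtain v where v: "v \<in> carrier_vec N" "X0 *\<^sub>v v = 0\<^sub>v n" "U *\<^sub>v v = ?w"
      using surj[OF _ w, of "0\<^sub>v n"] by auto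
    then obtain a where a: "a \<in> carrier_vec (dim_col KX)" "KX *\<^sub>v a = v"
      using kernel_basis_matrix_surj[OF KX, of v] X0 by auto
    \<comment> \<open>The combination \<open>v\<close> of experiments has zero initial state and
      input \<open>?w\<close>, so its final state is the pure input response.\<close>
    have "(X * KX) *\<^sub>v a = X *\<^sub>v v" using assoc_mult_mat_vec[OF X KXc a(1)] a(2) by simp
    also have "\<dots> = P *\<^sub>v (X0 *\<^sub>v v) + C *\<^sub>v (U *\<^sub>v v)"
      unfolding X_eq by (simp only: add_mult_distrib_mat_vec[OF PX0 CU v(1)]
          assoc_mult_mat_vec[OF P X0 v(1)] assoc_mult_mat_vec[OF C U v(1)])
    also have "\<dots> = C *\<^sub>v ?w"
    proof -
      have "P *\<^sub>v 0\<^sub>v n = 0\<^sub>v n" using P by auto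
      then show ?thesis using v mult_mat_vec_carrier[OF C w] by simp
    qed
    finally have "(X * KX) *\<^sub>v a = C *\<^sub>v ?w" .
    then have "state A B x u t = Q *\<^sub>v x + (X * KX) *\<^sub>v a" using PC[OF x u] Q by simp
    moreover have "?w = (U * KX) *\<^sub>v a" using assoc_mult_mat_vec[OF U KXc a(1)] a(2) v(3) by simp
    ultimately show ?thesis using a(1) by blast
  qed
qed

section \<open>Concatenation of the segments\<close>

theorem theorem3p1:
  fixes n m M l :: nat
    and A B :: "real mat"
    and T N k :: "nat \<Rightarrow> nat"
    and U X0 X :: "nat \<Rightarrow> real mat"
    and K :: "real mat \<Rightarrow> real mat"
    and x0 :: "real vec"
    and u :: "nat \<Rightarrow> real vec"
  assumes A: "A \<in> carrier_mat n n" and B: "B \<in> carrier_mat n m"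
    and T_pos: "\<forall>i\<in>{1..M}. 0 < T i" and T_distinct: "inj_on T {1..M}"
    and data: "\<forall>i\<in>{1..M}. experiment_data n m A B (T i) (N i) (U i) (X0 i) (X i)"
    and k: "\<forall>i\<in>{1..l}. k i \<in> {1..M}"
    and rank: "\<forall>i\<in>{1..l}. full_row_rank (X0 (k i) @\<^sub>r U (k i))"
    and K: "\<forall>C. kernel_basis_matrix C (K C)"
    and x0: "x0 \<in> carrier_vec n"
    and u: "\<forall>t<(\<Sum>i = 1..l. T (k i)). u t \<in> carrier_vec m"
  shows
    "let Ttot = (\<Sum>i = 1..l. T (k i));
         q = (\<lambda>i. kernel_dim (X0 (k i)));
         Ut = (\<lambda>i. U (k i) * K (X0 (k i)));
         Xt = (\<lambda>i. X (k i) * K (X0 (k i)));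
         Q = (\<lambda>i. X (k i) * K (U (k i)) * pinv (X0 (k i) * K (U (k i))));
         uT = input_stack u Ttot;
         xs = stack (map (\<lambda>j. state A B x0 u (\<Sum>i = 1..j. T (k i))) [0..<Suc l])
     in \<exists>\<alpha>\<in>carrier_vec ((\<Sum>i = 1..l. q i) + n).
          uT @\<^sub>v xs = (G_mat n l Ut @\<^sub>r H_mat n l Xt Q) *\<^sub>v \<alpha>"
proof -
  define Ut Xt Q where "Ut = (\<lambda>i. U (k i) * K (X0 (k i)))"
    and "Xt = (\<lambda>i. X (k i) * K (X0 (k i)))"
    and "Q = (\<lambda>i. X (k i) * K (U (k i)) * pinv (X0 (k i) * K (U (k i))))"
  define q where "q = (\<lambda>i. kernel_dim (X0 (k i)))"
  define s where "s = (\<lambda>j. \<Sum>i = 1..j. T (k i))"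
  define z where "z = (\<lambda>j. state A B x0 u (s j))"
  \<comment> \<open>Segment \<open>i\<close> starts at the preceding sampling time
    \<open>s (i - 1)\<close>. Only indices i \<ge> 1 occur, so the subtraction is never
    truncated.\<close>
  define w where "w = (\<lambda>i. input_stack (\<lambda>t. u (s (i - 1) + t)) (T (k i)))"
  have s0: "s 0 = 0" and s_Suc: "s (Suc j) = s j + T (k (Suc j))" for j by (simp_all add: s_def)
  have s_mono: "s j \<le> s l" if "j \<le> l" for j
    unfolding s_def using that by (intro sum_mono2) auto
  have z_carrier: "z j \<in> carrier_vec n" if "j \<le> l" for j
    unfolding z_def using u s_mono[OF that]
    by (intro state_carrier[OF A B x0]) (auto simp: s_def)
  have segment: "Q i \<in> carrier_mat n n \<and> Ut i \<in> carrier_mat (m * T (k i)) (q i) \<and>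
      Xt i \<in> carrier_mat n (q i) \<and>
      (\<exists>a\<in>carrier_vec (q i). w i = Ut i *\<^sub>v a \<and> z i = Q i *\<^sub>v z (i - 1) + Xt i *\<^sub>v a)"
    if i: "i \<in> {1..l}" for i
  proof -
    have d: "experiment_data n m A B (T (k i)) (N (k i)) (U (k i)) (X0 (k i)) (X (k i))"
      and r: "full_row_rank (X0 (k i) @\<^sub>r U (k i))" using data k rank i by auto
    note seg = experiment_data_segment[OF A B d r K[rule_format] K[rule_format], folded Q_def]
    have dim: "dim_col (K (X0 (k i))) = q i"
      unfolding q_def by (rule kernel_basis_matrix_dim_col[OF K[rule_format]])
    have "dim_row (K (X0 (k i))) = N (k i)"
      using K d by (auto simp: kernel_basis_matrix_def experiment_data_def)
    then have "K (X0 (k i)) \<in> carrier_mat (N (k i)) (q i)" using dim by auto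
    then have "Ut i \<in> carrier_mat (m * T (k i)) (q i)" "Xt i \<in> carrier_mat n (q i)"
      using d by (auto simp: Ut_def Xt_def experiment_data_def)
    moreover have i': "Suc (i - 1) = i" "i - 1 \<le> l" using i by auto
    have si: "s i = s (i - 1) + T (k i)" using s_Suc[of "i - 1"] i' by simp
    have "\<forall>t<T (k i). u (s (i - 1) + t) \<in> carrier_vec m"
      using u s_mono[of i] si i by (auto simp: s_def)
    from seg(2)[OF z_carrier[OF i'(2)] this]
    have "\<exists>a\<in>carrier_vec (q i). w i = Ut i *\<^sub>v a \<and> z i = Q i *\<^sub>v z (i - 1) + Xt i *\<^sub>v a"
      unfolding dim w_def Ut_def Xt_def Q_def z_def si state_add .
    moreover have "Q i \<in> carrier_mat n n" using seg(1) by (simp add: Q_def)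
    ultimately show ?thesis by blast
  qed
  \<comment> \<open>Each segment has its own coefficient vector; choice collects them into a family
    \<open>a\<close>, the blocks of \<alpha>.\<close>
  then have "\<forall>i\<in>{1..l}. \<exists>a. a \<in> carrier_vec (q i) \<and> w i = Ut i *\<^sub>v a \<and>
      z i = Q i *\<^sub>v z (i - 1) + Xt i *\<^sub>v a" by blast
  then obtain a where a: "\<forall>i\<in>{1..l}. a i \<in> carrier_vec (q i) \<and> w i = Ut i *\<^sub>v a i \<and>
      z i = Q i *\<^sub>v z (i - 1) + Xt i *\<^sub>v a i" by (rule bchoice[THEN exE])
  have z_Suc: "\<forall>i<l. z (Suc i) = Q (Suc i) *\<^sub>v z i + Xt (Suc i) *\<^sub>v a (Suc i)"
    using a by (auto dest!: bspec[of _ _ "Suc _"])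
  \<comment> \<open>Each further segment lands on top of the stack, which produces the descending
    order of the blocks.\<close>
  have "input_stack u (s j) = stack (map w (rev [1..<Suc j]))" for j
  proof (induction j)
    case (Suc j)
    have "input_stack u (s (Suc j)) = w (Suc j) @\<^sub>v input_stack u (s j)"
      unfolding s_Suc input_stack_add by (simp add: w_def)
    then show ?case using Suc.IH by simp
  qed (simp add: s0 input_stack_def)
  also have "map w (rev [1..<Suc l]) = map (\<lambda>i. Ut i *\<^sub>v a i) (rev [1..<Suc l])"
    using a by (intro map_cong) auto
  finally have uT: "input_stack u (s l) = stack (map (\<lambda>i. Ut i *\<^sub>v a i) (rev [1..<Suc l]))" .
  have carriers: "\<forall>i\<in>{1..l}. Ut i \<in> carrier_mat (m * T (k i)) (q i)"
    "\<forall>i\<in>{1..l}. Xt i \<in> carrier_mat n (q i)" "\<forall>i\<in>{1..l}. Q i \<in> carrier_mat n n"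
    "\<forall>i\<in>{1..l}. a i \<in> carrier_vec (q i)"
    using segment a by blast+
  \<comment> \<open>The bottom block of \<alpha> is \<open>z 0\<close>, which is the initial state
    \<open>x0\<close> because \<open>s 0 = 0\<close>.\<close>
  note GH = G_H_mult_vec[OF carriers z_carrier[OF le0] z_Suc]
  have "\<exists>\<alpha>\<in>carrier_vec ((\<Sum>i = 1..l. q i) + n).
      input_stack u (s l) @\<^sub>v stack (map z [0..<Suc l])
        = (G_mat n l Ut @\<^sub>r H_mat n l Xt Q) *\<^sub>v \<alpha>"
    using GH(1) GH(2)[folded uT, symmetric] by (rule bexI[rotated])
  then show ?thesis
    unfolding Let_def Ut_def Xt_def Q_def q_def s_def z_def .
qed
end
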